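(* Let $N\geq 2$ and $d\geq 1$ be integers, let $\varnothing\neq S\subseteq\mathbb Z_N^d$, and let $f:\mathbb Z_N^d\to\mathbb C$ be a function with $f\neq0$ that is supported on $S$ (i.e. $f(x)=0$ for $x\notin S$). Then for $2\leq p<\infty$, $$\|\widehat f\|_\infty\leq N^{-\frac{d}{2}}|S|^{\frac{1}{2}}\min\{\operatorname{FR}(f),\operatorname{FR}(1_S)\}^{1-\frac{2}{p}}\,\|\widehat f\|_p .$$
   Context: $\mathbb Z_N=\mathbb Z/N\mathbb Z$. For $f:\mathbb Z_N^d\to\mathbb C$ the unitary Fourier transform is $\widehat f(\xi)=N^{-d/2}\sum_{x\in\mathbb Z_N^d}f(x)e^{-2\pi i x\cdot\xi/N}$, $\xi\in\mathbb Z_N^d$. All norms use counting measure: $\|f\|_r=(\sum_x|f(x)|^r)^{1/r}$ for $1\le r<\infty$ and $\|f\|_\infty=\max_x|f(x)|$ (likewise for $\widehat f$). $1_S$ is the indicator function of $S$. The Fourier ratio of a nonzero $f$ is $\operatorname{FR}(f)=\|\widehat f\|_1/\|\widehat f\|_2$. *)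

theory Defs
  imports "HOL-Analysis.Analysis"
begin

text \<open>
  Elements of $(\mathbf{Z}/N\mathbf{Z})^d$ are represented by their coordinate functions on
  \<open>{..<d}\<close> with values the residues \<open>{..<N}\<close>; extensionality (\<open>Pi\<^sub>E\<close>) makes the representation
  unique.  A function on $(\mathbf{Z}/N\mathbf{Z})^d$ is a function on \<open>nat \<Rightarrow> nat\<close> of which only the
  values on \<open>ZNd N d\<close> matter.
\<close>

definition ZNd :: "nat \<Rightarrow> nat \<Rightarrow> (nat \<Rightarrow> nat) set" where
  "ZNd N d = {..<d} \<rightarrow>\<^sub>E {..<N}"

text \<open>
  The dot product is formed in the natural numbers; its class modulo \<open>N\<close>, and hence the
  exponential in the Fourier transform, does not depend on the choice of representatives.
\<close>

definition dot :: "nat \<Rightarrow> (nat \<Rightarrow> nat) \<Rightarrow> (nat \<Rightarrow> nat) \<Rightarrow> nat" where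
  "dot d x \<xi> = (\<Sum>i<d. x i * \<xi> i)"

definition fourier :: "nat \<Rightarrow> nat \<Rightarrow> ((nat \<Rightarrow> nat) \<Rightarrow> complex) \<Rightarrow> (nat \<Rightarrow> nat) \<Rightarrow> complex" where
  "fourier N d f \<xi> =
     of_real (real N powr (- real d / 2)) *
     (\<Sum>x\<in>ZNd N d. f x * exp (- 2 * of_real pi * \<i> * of_nat (dot d x \<xi>) / of_nat N))"

definition lnorm :: "nat \<Rightarrow> nat \<Rightarrow> real \<Rightarrow> ((nat \<Rightarrow> nat) \<Rightarrow> complex) \<Rightarrow> real" where
  "lnorm N d r f = (\<Sum>x\<in>ZNd N d. cmod (f x) powr r) powr (1 / r)"

definition supnorm :: "nat \<Rightarrow> nat \<Rightarrow> ((nat \<Rightarrow> nat) \<Rightarrow> complex) \<Rightarrow> real" where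
  "supnorm N d f = Max ((\<lambda>x. cmod (f x)) ` ZNd N d)"

definition FR :: "nat \<Rightarrow> nat \<Rightarrow> ((nat \<Rightarrow> nat) \<Rightarrow> complex) \<Rightarrow> real" where
  "FR N d f = lnorm N d 1 (fourier N d f) / lnorm N d 2 (fourier N d f)"

end

theory Submission
  imports Defs
begin

text \<open>
  Since \<open>f = f \<cdot> 1\<^sub>S\<close>, the transform of \<open>f\<close> is \<open>N\<close> to the power \<open>-d/2\<close> times a correlation of the
  transforms of \<open>f\<close> and \<open>1\<^sub>S\<close>, so Hoelder's inequality bounds its supremum by the product of an
  \<open>\<ell>\<^sup>p\<close> norm and a dual \<open>\<ell>\<^sup>q\<close> norm.  Interpolating the \<open>\<ell>\<^sup>q\<close> norm of the transform of \<open>1\<^sub>S\<close> between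
  \<open>\<ell>\<^sup>1\<close> and \<open>\<ell>\<^sup>2\<close> gives the factor \<open>FR(1\<^sub>S)\<close>.  For the factor \<open>FR(f)\<close>, use the case \<open>p = q = 2\<close> and
  interpolate the \<open>\<ell>\<^sup>2\<close> norm of the transform of \<open>f\<close> between \<open>\<ell>\<^sup>1\<close> and \<open>\<ell>\<^sup>p\<close>.
\<close>

section \<open>Hoelder's inequality and interpolation of norms\<close>

text \<open>Dividing \<open>u\<close> and \<open>v\<close> by their sums, Young's inequality bounds
  each term by a weighted mean, and these means sum to \<alpha> + \<beta> = 1. This weighted form
  yields both \<open>Hoelder_lnorm\<close> and \<open>lnorm_interpolation\<close>.\<close>

lemma sum_powr_mult_powr_le:
  fixes u v :: "'a \<Rightarrow> real"
  assumes "finite A" "\<And>x. x \<in> A \<Longrightarrow> 0 \<le> u x" "\<And>x. x \<in> A \<Longrightarrow> 0 \<le> v x"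
    and "0 \<le> \<alpha>" "0 \<le> \<beta>" "\<alpha> + \<beta> = 1"
  shows "(\<Sum>x\<in>A. u x powr \<alpha> * v x powr \<beta>) \<le> sum u A powr \<alpha> * sum v A powr \<beta>"
proof (cases "sum u A > 0 \<and> sum v A > 0")
  case False
  have "sum u A \<ge> 0" "sum v A \<ge> 0"
    using assms by (auto intro: sum_nonneg)
  then have "sum u A = 0 \<or> sum v A = 0"
    using False by linarith
  then have "(\<forall>x\<in>A. u x = 0) \<or> (\<forall>x\<in>A. v x = 0)"
    using assms(1-3) by (simp add: sum_nonneg_eq_0_iff)
  \<comment> \<open>This covers zero exponents too, because \<open>0 powr 0 = 0\<close>.\<close>
  then have "(\<Sum>x\<in>A. u x powr \<alpha> * v x powr \<beta>) = 0"
    by auto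
  then show ?thesis by simp
next
  case True
  define U V where "U = sum u A" and "V = sum v A"
  have UV: "U > 0" "V > 0" using True by (auto simp: U_def V_def)
  have "u x powr \<alpha> * v x powr \<beta> \<le> U powr \<alpha> * V powr \<beta> * (\<alpha> * (u x / U) + \<beta> * (v x / V))"
    if "x \<in> A" for x
  proof (cases "u x = 0 \<or> v x = 0")
    case True
    then show ?thesis
      using assms UV that by auto
  next
    case False
    then have pos: "u x > 0" "v x > 0"
      using assms(2,3)[OF that] by auto
    have "u x powr \<alpha> * v x powr \<beta> =
        U powr \<alpha> * V powr \<beta> * ((u x / U) powr \<alpha> * (v x / V) powr \<beta>)"
      using pos UV by (simp add: powr_divide)
    also have "\<dots> \<le> U powr \<alpha> * V powr \<beta> * (\<alpha> * (u x / U) + \<beta> * (v x / V))"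
      using pos UV assms by (intro mult_left_mono Youngs_inequality_0) auto
    finally show ?thesis .
  qed
  then have "(\<Sum>x\<in>A. u x powr \<alpha> * v x powr \<beta>) \<le>
      (\<Sum>x\<in>A. U powr \<alpha> * V powr \<beta> * (\<alpha> * (u x / U) + \<beta> * (v x / V)))"
    by (rule sum_mono)
  also have "\<dots> = U powr \<alpha> * V powr \<beta> * (\<alpha> * (sum u A / U) + \<beta> * (sum v A / V))"
    by (simp add: sum_distrib_left[symmetric] sum.distrib sum_divide_distrib[symmetric])
  also have "\<dots> = U powr \<alpha> * V powr \<beta>"
    using UV assms(6) by (simp flip: U_def V_def)
  finally show ?thesis by (simp add: U_def V_def)
qed

lemma finite_ZNd [simp]: "finite (ZNd N d)"
  by (simp add: ZNd_def finite_PiE)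

lemma lnorm_nonneg [simp]: "lnorm N d r f \<ge> 0"
  by (simp add: lnorm_def)

lemma Hoelder_lnorm:
  assumes "p > 1" "q > 1" "1 / p + 1 / q = 1"
  shows "(\<Sum>x\<in>ZNd N d. cmod (f x) * cmod (g x)) \<le> lnorm N d p f * lnorm N d q g"
  using sum_powr_mult_powr_le[of "ZNd N d" "\<lambda>x. cmod (f x) powr p" "\<lambda>x. cmod (g x) powr q"
      "1 / p" "1 / q"] assms
  by (simp add: powr_powr lnorm_def)

lemma lnorm_interpolation:
  assumes "r > 0" "a > 0" "b > 0" "0 \<le> \<theta>" "\<theta> \<le> 1"
    and "1 / r = (1 - \<theta>) / a + \<theta> / b"
  shows "lnorm N d r f \<le> lnorm N d a f powr (1 - \<theta>) * lnorm N d b f powr \<theta>"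
proof -
  \<comment> \<open>With these weights |f|^r is the product of (|f|^a)^\<alpha> and (|f|^b)^\<beta>,
    and the hypothesis on \<open>1 / r\<close> says exactly that \<alpha> + \<beta> = 1.\<close>
  define \<alpha> \<beta> where "\<alpha> = r * (1 - \<theta>) / a" and "\<beta> = r * \<theta> / b"
  have "r * (1 / r) = \<alpha> + \<beta>"
    unfolding assms(6) by (simp add: \<alpha>_def \<beta>_def algebra_simps)
  then have sum1: "\<alpha> + \<beta> = 1"
    using assms(1) by simp
  have nonneg: "0 \<le> \<alpha>" "0 \<le> \<beta>"
    using assms by (auto simp: \<alpha>_def \<beta>_def)
  have weights: "a * \<alpha> + b * \<beta> = r"
  proof -
    have "a * \<alpha> = r * (1 - \<theta>)" "b * \<beta> = r * \<theta>"
      using assms by (simp_all add: \<alpha>_def \<beta>_def)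
    then show ?thesis by (simp add: algebra_simps)
  qed
  have "(\<Sum>x\<in>ZNd N d. cmod (f x) powr r) =
      (\<Sum>x\<in>ZNd N d. (cmod (f x) powr a) powr \<alpha> * (cmod (f x) powr b) powr \<beta>)"
    by (simp add: powr_powr weights flip: powr_add)
  also have "\<dots> \<le> (\<Sum>x\<in>ZNd N d. cmod (f x) powr a) powr \<alpha> * (\<Sum>x\<in>ZNd N d. cmod (f x) powr b) powr \<beta>"
    by (rule sum_powr_mult_powr_le) (use sum1 nonneg in auto)
  finally have "lnorm N d r f \<le>
      ((\<Sum>x\<in>ZNd N d. cmod (f x) powr a) powr \<alpha> * (\<Sum>x\<in>ZNd N d. cmod (f x) powr b) powr \<beta>) powr (1 / r)"
    unfolding lnorm_def using assms(1) by (intro powr_mono2) (auto intro: sum_nonneg)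
  also have "\<dots> = lnorm N d a f powr (1 - \<theta>) * lnorm N d b f powr \<theta>"
    using assms(1) by (simp add: lnorm_def powr_mult powr_powr \<alpha>_def \<beta>_def)
  finally show ?thesis .
qed

section \<open>Roots of unity and orthogonality of characters\<close>

definition root_unity :: "nat \<Rightarrow> nat \<Rightarrow> complex" where
  "root_unity N k = exp (- 2 * of_real pi * \<i> * of_nat k / of_nat N)"

text \<open>The positive exponent is the form in which \<open>complex_root_unity_eq\<close> compares
  roots of unity.\<close>

lemma root_unity_eq_inverse: "root_unity N k = inverse (exp (2 * of_real pi * \<i> * of_nat k / of_nat N))"
  by (simp add: root_unity_def flip: exp_minus)

lemma root_unity_0 [simp]: "root_unity N 0 = 1"
  by (simp add: root_unity_def)

lemma root_unity_add: "root_unity N (j + k) = root_unity N j * root_unity N k"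
  by (simp add: root_unity_def ring_distribs add_divide_distrib diff_divide_distrib flip: exp_add)

lemma root_unity_sum: "root_unity N (sum k A) = (\<Prod>i\<in>A. root_unity N (k i))"
  by (induction A rule: infinite_finite_induct) (auto simp: root_unity_add)

lemma root_unity_mult: "root_unity N (j * k) = root_unity N j ^ k"
  by (induction k) (auto simp: root_unity_add)

lemma norm_root_unity [simp]: "cmod (root_unity N k) = 1"
  by (simp add: root_unity_def)

lemma root_unity_mult_cnj [simp]: "root_unity N k * cnj (root_unity N k) = 1"
  by (simp add: complex_norm_square[symmetric])

lemma root_unity_eq_iff:
  assumes "N \<ge> 1"
  shows "root_unity N j = root_unity N k \<longleftrightarrow> j mod N = k mod N"
  using complex_root_unity_eq[OF assms, of j k] by (simp add: root_unity_eq_inverse)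

text \<open>For distinct residues this is a geometric sum whose ratio z satisfies z^N = 1 but
  differs from 1.\<close>

lemma sum_root_unity:
  assumes "N \<ge> 1" "a < N" "b < N"
  shows "(\<Sum>k<N. root_unity N (a * k) * cnj (root_unity N (b * k))) = (if a = b then of_nat N else 0)"
proof (cases "a = b")
  case True
  then show ?thesis by simp
next
  case False
  define z where "z = root_unity N a * cnj (root_unity N b)"
  have "root_unity N a \<noteq> root_unity N b"
    using False assms by (simp add: root_unity_eq_iff)
  moreover have "root_unity N a = z * root_unity N b"
    using root_unity_mult_cnj[of N b] by (simp add: z_def mult_ac)
  ultimately have "z \<noteq> 1" by auto
  moreover have "root_unity N (c * N) = 1" for c
    using root_unity_eq_iff[OF assms(1), of "c * N" 0] by simp
  then have "z ^ N = 1"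
    by (simp add: z_def power_mult_distrib flip: root_unity_mult complex_cnj_power)
  ultimately show ?thesis
    using False by (simp add: root_unity_mult z_def[symmetric] geometric_sum flip: power_mult_distrib)
qed

definition character :: "nat \<Rightarrow> nat \<Rightarrow> (nat \<Rightarrow> nat) \<Rightarrow> (nat \<Rightarrow> nat) \<Rightarrow> complex" where
  "character N d x \<xi> = root_unity N (dot d x \<xi>)"

lemma fourier_character:
  "fourier N d f \<xi> = of_real (real N powr (- real d / 2)) * (\<Sum>x\<in>ZNd N d. f x * character N d x \<xi>)"
  by (simp add: fourier_def character_def root_unity_def)

text \<open>The sum over the product set factors into d one-dimensional sums; a single coordinate in
  which x and y differ makes the product vanish.\<close>

lemma character_orthogonality:
  assumes "N \<ge> 1" "x \<in> ZNd N d" "y \<in> ZNd N d"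
  shows "(\<Sum>\<xi>\<in>ZNd N d. character N d x \<xi> * cnj (character N d y \<xi>)) = (if x = y then of_nat N ^ d else 0)"
proof -
  have lt: "x i < N" "y i < N" if "i < d" for i
    using assms that by (auto simp: ZNd_def)
  have "(\<Sum>\<xi>\<in>ZNd N d. character N d x \<xi> * cnj (character N d y \<xi>)) =
      (\<Sum>\<xi>\<in>ZNd N d. \<Prod>i<d. root_unity N (x i * \<xi> i) * cnj (root_unity N (y i * \<xi> i)))"
    by (simp add: character_def dot_def root_unity_sum prod.distrib)
  also have "\<dots> = (\<Prod>i<d. \<Sum>k<N. root_unity N (x i * k) * cnj (root_unity N (y i * k)))"
    unfolding ZNd_def by (subst prod_sum_PiE) auto
  also have "\<dots> = (\<Prod>i<d. if x i = y i then of_nat N else 0)"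
    using assms(1) lt by (intro prod.cong sum_root_unity) auto
  also have "\<dots> = (if x = y then of_nat N ^ d else 0)"
  proof (cases "x = y")
    case False
    then obtain i where "i < d" "x i \<noteq> y i"
      using assms(2,3) PiE_ext[of x "{..<d}" "\<lambda>_. {..<N}" y] by (auto simp: ZNd_def)
    then show ?thesis
      using False by (auto intro!: prod_zero)
  qed simp
  finally show ?thesis .
qed

section \<open>Parseval and Plancherel\<close>

lemma parseval:
  assumes "N \<ge> 1"
  shows "(\<Sum>\<xi>\<in>ZNd N d. fourier N d f \<xi> * cnj (fourier N d g \<xi>)) = (\<Sum>x\<in>ZNd N d. f x * cnj (g x))"
proof -
  define c where "c = real N powr (- real d / 2)"
  \<comment> \<open>The normalising factors of the two transforms cancel the N^d that orthogonality
    produces on the diagonal.\<close>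
  have "c * c * real N ^ d = 1"
    using assms by (simp add: c_def powr_minus field_simps flip: powr_add powr_realpow)
  then have "complex_of_real (c * c * real N ^ d) = 1" by simp
  then have c: "of_real c * of_real c * of_nat N ^ d = (1 :: complex)"
    by simp
  let ?Z = "ZNd N d" and ?\<chi> = "character N d"
  have "(\<Sum>\<xi>\<in>?Z. fourier N d f \<xi> * cnj (fourier N d g \<xi>)) =
      (\<Sum>\<xi>\<in>?Z. \<Sum>x\<in>?Z. \<Sum>y\<in>?Z. of_real c * of_real c * (f x * cnj (g y) * (?\<chi> x \<xi> * cnj (?\<chi> y \<xi>))))"
  proof (intro sum.cong refl)
    fix \<xi>
    have "fourier N d f \<xi> * cnj (fourier N d g \<xi>) = of_real c * of_real c *
        ((\<Sum>x\<in>?Z. f x * ?\<chi> x \<xi>) * (\<Sum>y\<in>?Z. cnj (g y) * cnj (?\<chi> y \<xi>)))"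
      unfolding fourier_character c_def[symmetric] by (simp add: cnj_sum mult_ac)
    also have "\<dots> = (\<Sum>x\<in>?Z. \<Sum>y\<in>?Z. of_real c * of_real c * (f x * cnj (g y) * (?\<chi> x \<xi> * cnj (?\<chi> y \<xi>))))"
      unfolding sum_product by (simp add: sum_distrib_left mult_ac)
    finally show "fourier N d f \<xi> * cnj (fourier N d g \<xi>) = \<dots>" .
  qed
  also have "\<dots> = (\<Sum>x\<in>?Z. \<Sum>y\<in>?Z. \<Sum>\<xi>\<in>?Z. of_real c * of_real c * (f x * cnj (g y) * (?\<chi> x \<xi> * cnj (?\<chi> y \<xi>))))"
    by (rule trans[OF sum.swap]) (intro sum.cong refl sum.swap)
  also have "\<dots> = (\<Sum>x\<in>?Z. \<Sum>y\<in>?Z. of_real c * of_real c * (f x * cnj (g y) * (\<Sum>\<xi>\<in>?Z. ?\<chi> x \<xi> * cnj (?\<chi> y \<xi>))))"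
    by (simp add: sum_distrib_left)
  also have "\<dots> = (\<Sum>x\<in>?Z. \<Sum>y\<in>?Z. if x = y then f x * cnj (g y) else 0)"
    using c by (intro sum.cong refl) (simp add: character_orthogonality[OF assms] mult_ac)
  also have "\<dots> = (\<Sum>x\<in>?Z. f x * cnj (g x))"
    by simp
  finally show ?thesis .
qed

lemma plancherel:
  assumes "N \<ge> 1"
  shows "lnorm N d 2 (fourier N d f) = lnorm N d 2 f"
proof -
  have "complex_of_real (\<Sum>x\<in>ZNd N d. (cmod (fourier N d f x))\<^sup>2) =
      complex_of_real (\<Sum>x\<in>ZNd N d. (cmod (f x))\<^sup>2)"
    unfolding of_real_sum complex_norm_square by (rule parseval[OF assms])
  then have "(\<Sum>x\<in>ZNd N d. (cmod (fourier N d f x))\<^sup>2) = (\<Sum>x\<in>ZNd N d. (cmod (f x))\<^sup>2)"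
    by (rule of_real_eq_iff[THEN iffD1])
  then show ?thesis
    by (simp add: lnorm_def)
qed

section \<open>Translation of frequencies\<close>

text \<open>Reduction modulo N and restriction to \<open>{..<d}\<close> return the unique
  representative of the sum, so no condition on \<xi> is needed for the result to lie in
  \<open>ZNd N d\<close> when N is positive.\<close>

definition ZNd_add :: "nat \<Rightarrow> nat \<Rightarrow> (nat \<Rightarrow> nat) \<Rightarrow> (nat \<Rightarrow> nat) \<Rightarrow> nat \<Rightarrow> nat" where
  "ZNd_add N d \<xi> \<eta> = (\<lambda>i\<in>{..<d}. (\<xi> i + \<eta> i) mod N)"

text \<open>Cancellation modulo N gives injectivity; finiteness then gives surjectivity without an
  explicit inverse.\<close>

lemma bij_betw_ZNd_add:
  assumes "N \<ge> 1"
  shows "bij_betw (ZNd_add N d \<xi>) (ZNd N d) (ZNd N d)"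
proof -
  have into: "ZNd_add N d \<xi> ` ZNd N d \<subseteq> ZNd N d"
    unfolding ZNd_add_def ZNd_def using assms by (intro image_subsetI restrict_PiE_iff[THEN iffD2]) simp
  have "inj_on (ZNd_add N d \<xi>) (ZNd N d)"
  proof (rule inj_onI)
    fix \<eta> \<zeta> assume *: "\<eta> \<in> ZNd N d" "\<zeta> \<in> ZNd N d" "ZNd_add N d \<xi> \<eta> = ZNd_add N d \<xi> \<zeta>"
    show "\<eta> = \<zeta>"
    proof (rule PiE_ext)
      show "\<eta> \<in> {..<d} \<rightarrow>\<^sub>E {..<N}" "\<zeta> \<in> {..<d} \<rightarrow>\<^sub>E {..<N}"
        using * by (auto simp: ZNd_def)
      fix i assume i: "i \<in> {..<d}"
      then have "(\<xi> i + \<eta> i) mod N = (\<xi> i + \<zeta> i) mod N"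
        using fun_cong[OF *(3), of i] by (simp add: ZNd_add_def)
      then have "\<eta> i mod N = \<zeta> i mod N"
        by (simp add: nat_mod_eq_iff add.assoc)
      moreover have "\<eta> i < N" "\<zeta> i < N"
        using * i by (auto simp: ZNd_def)
      ultimately show "\<eta> i = \<zeta> i" by simp
    qed
  qed
  with into show ?thesis
    by (simp add: bij_betw_def endo_inj_surj)
qed

lemma character_add:
  assumes "N \<ge> 1"
  shows "character N d x (ZNd_add N d \<xi> \<eta>) = character N d x \<xi> * character N d x \<eta>"
proof -
  have "root_unity N (x i * ((\<xi> i + \<eta> i) mod N)) = root_unity N (x i * \<xi> i) * root_unity N (x i * \<eta> i)" for i
  proof -
    have "root_unity N (x i * ((\<xi> i + \<eta> i) mod N)) = root_unity N (x i * (\<xi> i + \<eta> i))"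
      using assms by (simp add: root_unity_eq_iff mod_mult_right_eq)
    then show ?thesis by (simp add: ring_distribs root_unity_add)
  qed
  then show ?thesis
    by (simp add: character_def dot_def root_unity_sum ZNd_add_def prod.distrib)
qed

lemma fourier_modulate:
  assumes "N \<ge> 1"
  shows "fourier N d (\<lambda>x. f x * character N d x \<xi>) \<eta> = fourier N d f (ZNd_add N d \<xi> \<eta>)"
  by (simp add: fourier_character character_add[OF assms] mult_ac)

lemma lnorm_shift:
  assumes "N \<ge> 1"
  shows "lnorm N d r (\<lambda>\<eta>. g (ZNd_add N d \<xi> \<eta>)) = lnorm N d r g"
  using sum.reindex_bij_betw[OF bij_betw_ZNd_add[OF assms], of "\<lambda>x. cmod (g x) powr r"]
  by (simp add: lnorm_def)

section \<open>Norm estimates and the Fourier ratio\<close>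

lemma norm_fourier_le_lnorm_lnorm:
  assumes "N \<ge> 1" "\<forall>x\<in>ZNd N d. x \<notin> S \<longrightarrow> f x = 0"
    and "p > 1" "q > 1" "1 / p + 1 / q = 1"
  shows "cmod (fourier N d f \<xi>) \<le> real N powr (- real d / 2) *
    (lnorm N d p (fourier N d f) * lnorm N d q (fourier N d (indicator S)))"
proof -
  define c where "c = real N powr (- real d / 2)"
  \<comment> \<open>The support condition permits the factor 1_S; the conjugate, harmless on a real
    function, matches the form of \<open>parseval\<close>.\<close>
  have "f x * character N d x \<xi> = (f x * character N d x \<xi>) * cnj (indicator S x)" if "x \<in> ZNd N d" for x
    using assms(2) that by (cases "x \<in> S") auto
  then have "fourier N d f \<xi> = of_real c * (\<Sum>x\<in>ZNd N d. (f x * character N d x \<xi>) * cnj (indicator S x))"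
    unfolding fourier_character c_def by (metis (no_types, lifting) sum.cong)
  \<comment> \<open>Modulating f by the character at \<xi> translates its transform, so Parseval
    gives a correlation. The translation later disappears from the norm by
    \<open>lnorm_shift\<close>.\<close>
  also have "\<dots> = of_real c *
      (\<Sum>\<eta>\<in>ZNd N d. fourier N d f (ZNd_add N d \<xi> \<eta>) * cnj (fourier N d (indicator S) \<eta>))"
    unfolding fourier_modulate[OF assms(1), symmetric] parseval[OF assms(1)] ..
  finally have "cmod (fourier N d f \<xi>) =
      c * cmod (\<Sum>\<eta>\<in>ZNd N d. fourier N d f (ZNd_add N d \<xi> \<eta>) * cnj (fourier N d (indicator S) \<eta>))"
    by (simp add: norm_mult c_def)
  also have "\<dots> \<le> c * (\<Sum>\<eta>\<in>ZNd N d. cmod (fourier N d f (ZNd_add N d \<xi> \<eta>)) * cmod (fourier N d (indicator S) \<eta>))"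
    by (intro mult_left_mono sum_norm_le) (auto simp: norm_mult c_def)
  also have "\<dots> \<le> c * (lnorm N d p (\<lambda>\<eta>. fourier N d f (ZNd_add N d \<xi> \<eta>)) * lnorm N d q (fourier N d (indicator S)))"
    by (intro mult_left_mono Hoelder_lnorm assms) (auto simp: c_def)
  finally show ?thesis
    by (simp add: lnorm_shift[OF assms(1)] c_def)
qed

lemma lnorm_indicator:
  assumes "S \<subseteq> ZNd N d" "r \<noteq> 0"
  shows "lnorm N d r (indicator S) = real (card S) powr (1 / r)"
proof -
  have "(\<Sum>x\<in>ZNd N d. cmod (indicator S x) powr r) = (\<Sum>x\<in>ZNd N d. indicator S x)"
    using assms by (intro sum.cong) (auto simp: indicator_def)
  also have "\<dots> = real (card S)"
    using assms by (simp add: indicator_def sum.If_cases Int_absorb1)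
  finally show ?thesis by (simp add: lnorm_def)
qed

text \<open>Since 1/q = (1 - 2/p)/1 + (2/p)/2, the interpolation parameter between exponents 1 and 2
  is 2/p. Splitting off one factor B leaves (A/B)^(1 - 2/p), a power of the Fourier ratio.\<close>

lemma lnorm_dual_le_FR:
  assumes "lnorm N d 2 (fourier N d f) > 0" "p \<ge> 2" "q > 1" "1 / p + 1 / q = 1"
  shows "lnorm N d q (fourier N d f) \<le> FR N d f powr (1 - 2 / p) * lnorm N d 2 (fourier N d f)"
proof -
  define A B where "A = lnorm N d 1 (fourier N d f)" and "B = lnorm N d 2 (fourier N d f)"
  have AB: "A \<ge> 0" "B > 0"
    using assms by (auto simp: A_def B_def)
  have "lnorm N d q (fourier N d f) \<le> A powr (1 - 2 / p) * B powr (2 / p)"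
    unfolding A_def B_def by (rule lnorm_interpolation) (use assms in \<open>auto simp: field_simps\<close>)
  also have "B powr (2 / p) = B / B powr (1 - 2 / p)"
    using AB by (simp add: powr_diff)
  finally show ?thesis
    using AB by (simp add: FR_def powr_divide flip: A_def B_def)
qed

lemma lnorm_2_le_FR:
  assumes "lnorm N d 2 (fourier N d f) > 0" "p \<ge> 2"
  shows "lnorm N d 2 (fourier N d f) \<le> FR N d f powr (1 - 2 / p) * lnorm N d p (fourier N d f)"
proof -
  define A B C where "A = lnorm N d 1 (fourier N d f)" and "B = lnorm N d 2 (fourier N d f)"
    and "C = lnorm N d p (fourier N d f)"
  \<comment> \<open>This solves 1/2 = (1 - \<theta>)/1 + \<theta>/p, and p \<ge> 2 ensures \<theta>
    \<le> 1.\<close>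
  define \<theta> where "\<theta> = p / (2 * (p - 1))"
  have ABC: "A \<ge> 0" "B > 0" "C \<ge> 0"
    using assms by (auto simp: A_def B_def C_def)
  have "B \<le> A powr (1 - \<theta>) * C powr \<theta>"
    unfolding A_def B_def C_def
    by (rule lnorm_interpolation) (use assms in \<open>auto simp: \<theta>_def field_simps\<close>)
  \<comment> \<open>The exponent 2 - 2/p is 1/\<theta>, chosen so that C appears to the first power;
    A then gets 1 - 2/p, and dividing by B^(1 - 2/p) forms the Fourier ratio.\<close>
  then have "B powr (2 - 2 / p) \<le> (A powr (1 - \<theta>) * C powr \<theta>) powr (2 - 2 / p)"
    using ABC assms by (intro powr_mono2) (auto simp: field_simps)
  also have "\<dots> = A powr ((1 - \<theta>) * (2 - 2 / p)) * C powr (\<theta> * (2 - 2 / p))"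
    by (simp add: powr_mult powr_powr)
  also have "\<theta> * (2 - 2 / p) = 1"
    using assms by (simp add: \<theta>_def field_simps)
  also have "(1 - \<theta>) * (2 - 2 / p) = 1 - 2 / p"
    using assms by (simp add: \<theta>_def divide_simps)
  also have "B powr (2 - 2 / p) = B * B powr (1 - 2 / p)"
    using ABC powr_add[of B 1 "1 - 2 / p"] by simp
  finally have "B \<le> A powr (1 - 2 / p) / B powr (1 - 2 / p) * C"
    using ABC by (simp add: field_simps)
  then show ?thesis
    using ABC by (simp add: FR_def powr_divide flip: A_def B_def C_def)
qed

theorem theorem1p1:
  fixes N d :: nat and S :: "(nat \<Rightarrow> nat) set"
    and f :: "(nat \<Rightarrow> nat) \<Rightarrow> complex" and p :: real
  assumes "N \<ge> 2" and "d \<ge> 1"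
    and "S \<noteq> {}" and "S \<subseteq> ZNd N d"
    and "\<exists>x\<in>ZNd N d. f x \<noteq> 0"
    and "\<forall>x\<in>ZNd N d. x \<notin> S \<longrightarrow> f x = 0"
    and "2 \<le> p"
  shows "supnorm N d (fourier N d f)
    \<le> real N powr (- real d / 2) * real (card S) powr (1 / 2)
      * min (FR N d f) (FR N d (indicator S)) powr (1 - 2 / p)
      * lnorm N d p (fourier N d f)"
proof -
  have N: "N \<ge> 1" using assms(1) by simp
  let ?c = "real N powr (- real d / 2)" and ?s = "real (card S) powr (1 / 2)"
    and ?P = "lnorm N d p (fourier N d f)"
  define q where "q = p / (p - 1)"
  have q: "q > 1" "1 / p + 1 / q = 1"
    using assms(7) by (auto simp: q_def field_simps)
  have norm_S: "lnorm N d 2 (fourier N d (indicator S)) = ?s"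
    by (simp add: plancherel[OF N] lnorm_indicator assms(4))
  have "card S > 0"
    using assms(3,4) finite_subset[OF assms(4)] by (simp add: card_gt_0_iff)
  then have s_pos: "?s > 0" by simp
  \<comment> \<open>By Plancherel the denominator of \<open>FR N d f\<close> is positive, as the
    interpolation bound requires.\<close>
  have "lnorm N d 2 f \<noteq> 0"
    using assms(5) by (auto simp: lnorm_def sum_nonneg_eq_0_iff)
  then have f_pos: "lnorm N d 2 (fourier N d f) > 0"
    using lnorm_nonneg[of N d 2 f] by (simp add: plancherel[OF N] del: lnorm_nonneg)
  have "cmod (fourier N d f \<xi>) \<le> ?c * ?s * min (FR N d f) (FR N d (indicator S)) powr (1 - 2 / p) * ?P" for \<xi>
  proof -
    have "cmod (fourier N d f \<xi>) \<le> ?c * (lnorm N d 2 (fourier N d f) * ?s)"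
      using norm_fourier_le_lnorm_lnorm[OF N assms(6), of 2 2 \<xi>] by (simp add: norm_S)
    also have "\<dots> \<le> ?c * ((FR N d f powr (1 - 2 / p) * ?P) * ?s)"
      by (intro mult_left_mono mult_right_mono lnorm_2_le_FR f_pos assms(7)) auto
    finally have 1: "cmod (fourier N d f \<xi>) \<le> ?c * ?s * FR N d f powr (1 - 2 / p) * ?P"
      by (simp add: mult_ac)
    have "cmod (fourier N d f \<xi>) \<le> ?c * (?P * lnorm N d q (fourier N d (indicator S)))"
      using norm_fourier_le_lnorm_lnorm[OF N assms(6), of p q \<xi>] q assms(7) by simp
    also have "\<dots> \<le> ?c * (?P * (FR N d (indicator S) powr (1 - 2 / p) * ?s))"
      using lnorm_dual_le_FR[of N d "indicator S" p q] s_pos q assms(7)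
      by (intro mult_left_mono) (auto simp: norm_S)
    finally have 2: "cmod (fourier N d f \<xi>) \<le> ?c * ?s * FR N d (indicator S) powr (1 - 2 / p) * ?P"
      by (simp add: mult_ac)
    show ?thesis
      using 1 2 by (simp add: min_def)
  qed
  \<comment> \<open>Bounding \<open>Max\<close> through its elements requires a nonempty
    set.\<close>
  moreover have "ZNd N d \<noteq> {}"
    using assms(3,4) by auto
  ultimately show ?thesis
    by (simp add: supnorm_def)
qed

end
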